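(* The tableau calculus $\mathbf{TAB}_{\mathbf{I4}}$ is complete for the class of all strict partially ordered (SPO) models; that is, every formula $\varphi$ that is true at every world of every SPO model is provable in $\mathbf{TAB}_{\mathbf{I4}}$.
   Context: **Formulas.** Let $\mathbf{Prop}$ (propositional variables) and $\mathbf{Nom}$ (nominals) be disjoint countably infinite sets. Formulas are $\varphi ::= p \mid i \mid \neg\varphi \mid \varphi\land\varphi \mid \varphi\lor\varphi \mid \Diamond\varphi \mid \Box\varphi \mid @_i\varphi$ with $p\in\mathbf{Prop}$, $i\in\mathbf{Nom}$. All formulas are taken in negation normal form (NNF: negation only in front of propositional variables and nominals; $\neg @_i\varphi$ is rewritten as $@_i\neg\varphi$, Boolean and modal operators as usual), and $\neg\varphi$ denotes the NNF of the negation of $\varphi$. **Semantics.** A model $\mathcal M=(W,R,V)$ has a non-empty set $W$, a binary relation $R$ on $W$, and $V:\mathbf{Prop}\cup\mathbf{Nom}\to\mathcal P(W)$ with $V(i)=\{i^V\}$ a singleton for each $i\in\mathbf{Nom}$. Satisfaction: $\mathcal M,w\models p$ iff $w\in V(p)$; $\mathcal M,w\models i$ iff $w=i^V$; Boolean connectives as usual; $\mathcal M,w\models\Diamond\varphi$ iff $\mathcal M,v\models\varphi$ for some $v$ with $wRv$; $\mathcal M,w\models\Box\varphi$ iff $\mathcal M,v\models\varphi$ for all $v$ with $wRv$; $\mathcal M,w\models@_i\varphi$ iff $\mathcal M,i^V\models\varphi$. An SPO model is a model whose $R$ is irreflexive and transitive. **Tableaus.** A tableau is a tree of formulas, built downwards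 from a root formula $@_i\varphi$, where $i\in\mathbf{Nom}$ does not occur in $\varphi$, by extending branches with the rules below (branches may a priori be infinite). We write $\varphi\in\Theta$ if $\varphi$ occurs in the branch $\Theta$. A branch $\Theta$ is closed if $@_i\varphi, @_i\neg\varphi\in\Theta$ for some $\varphi$, $i$; otherwise it is open. A tableau is closed if all its branches are closed. A closed branch is not extended, nor is a branch on which every formula that could be generated by applying a rule already exists; rules are not applied redundantly: each application must add a formula not already on the branch to every branch it produces. A formula $\varphi$ is provable if there is a closed tableau with root formula $@_i\neg\varphi$, where $i\in\mathbf{Nom}$ does not occur in $\varphi$. **Rules of $\mathbf{TAB}_{\mathbf{I4}}$** (premises are on the branch; conclusions are added to it): - $[Eq]$: add $@_i i$, for any nominal $i$ already occurring in the branch. - $[\land]$: from $@_i(\varphi\land\psi)$ add $@_i\varphi$ and $@_i\psi$. - $[\lor]$: from $@_i(\varphi\lor\psi)$ split the branch, adding $@_i\varphi$ on one side and $@_i\psi$ on the other. - $[\Diamond]$: from $@_i\Diamond\varphi$ which is not an accessibility formula, add $@_i\Diamond j$ and $@_j\varphi$, where $j$ is a nominal not occurring in the branch; it is applied at most once per formula. The formula $@_i\Diamond j$ so produced is called an accessibility formula. - $[\Box]$: from $@_i\Box\varphi$ and $@_i\Diamond j$ add $@_j\varphi$. - $[@]$: from $@_i@_j\varphi$ add $@_j\varphi$. - $[Id]$: from $@_i\varphi$, not an accessibility formula, and $@_i j$ add $@_j\varphi$. - $[Irr]$: add $@_i\Box\neg i$, for any nominal $i$ already occurring in the branch. - $[Trs]$: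 from $@_i\Box\varphi$ and $@_i\Diamond j$ add $@_j\Box\varphi$. - Restriction $(\mathcal D)$: $[\Diamond]$ can be applied to $@_i\Diamond\varphi$ on a branch $\Theta$ only if $i$ is a quasi-urfather on $\Theta$ (at the moment of application). **Quasi-urfathers.** $@_i\varphi$ is a prefixed subformula of $@_j\psi$ if $\varphi$ is a subformula of $\psi$. For a nominal $i$ occurring in $\Theta$, $T^\Theta(i)=T_1^\Theta(i)\cup T_2^\Theta(i)$, where $T_1^\Theta(i)$ is the set of $\varphi$ such that $@_i\varphi\in\Theta$ is a prefixed subformula of the root formula of $\Theta$, and $T_2^\Theta(i)$ is the set of $\psi$ such that $@_i\psi\in\Theta$ is a prefixed subformula of $@_j\Box\neg j$ for some $j$ occurring in the root formula. Nominals $i,j$ are twins in $\Theta$ if $T^\Theta(i)=T^\Theta(j)$. Write $i\prec_\Theta j$ if $j$ is introduced in $\Theta$ by applying $[\Diamond]$ to some $@_i\Diamond\varphi$; $\prec_\Theta^*$ is the reflexive transitive closure. A nominal $i$ is a quasi-urfather on $\Theta$ if there are no twins $j\neq k$ with $j\prec_\Theta^* i$ and $k\prec_\Theta^* i$. *)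

theory Defs
  imports Main "HOL-Library.Sublist"
begin

type_synonym pvar = nat
type_synonym nom = nat

datatype fm =
    Pro pvar
  | Nom nom
  | Neg fm
  | Con fm fm
  | Dis fm fm
  | Dia fm
  | Box fm
  | At nom fm

fun noms :: "fm \<Rightarrow> nom set" where
  "noms (Pro p) = {}"
| "noms (Nom i) = {i}"
| "noms (Neg \<phi>) = noms \<phi>"
| "noms (Con \<phi> \<psi>) = noms \<phi> \<union> noms \<psi>"
| "noms (Dis \<phi> \<psi>) = noms \<phi> \<union> noms \<psi>"
| "noms (Dia \<phi>) = noms \<phi>"
| "noms (Box \<phi>) = noms \<phi>"
| "noms (At i \<phi>) = insert i (noms \<phi>)"

fun subfms :: "fm \<Rightarrow> fm set" where
  "subfms (Pro p) = {Pro p}"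
| "subfms (Nom i) = {Nom i}"
| "subfms (Neg \<phi>) = insert (Neg \<phi>) (subfms \<phi>)"
| "subfms (Con \<phi> \<psi>) = insert (Con \<phi> \<psi>) (subfms \<phi> \<union> subfms \<psi>)"
| "subfms (Dis \<phi> \<psi>) = insert (Dis \<phi> \<psi>) (subfms \<phi> \<union> subfms \<psi>)"
| "subfms (Dia \<phi>) = insert (Dia \<phi>) (subfms \<phi>)"
| "subfms (Box \<phi>) = insert (Box \<phi>) (subfms \<phi>)"
| "subfms (At i \<phi>) = insert (At i \<phi>) (subfms \<phi>)"

fun nnf :: "fm \<Rightarrow> fm" where
  "nnf (Pro p) = Pro p"
| "nnf (Nom i) = Nom i"
| "nnf (Con \<phi> \<psi>) = Con (nnf \<phi>) (nnf \<psi>)"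
| "nnf (Dis \<phi> \<psi>) = Dis (nnf \<phi>) (nnf \<psi>)"
| "nnf (Dia \<phi>) = Dia (nnf \<phi>)"
| "nnf (Box \<phi>) = Box (nnf \<phi>)"
| "nnf (At i \<phi>) = At i (nnf \<phi>)"
| "nnf (Neg (Pro p)) = Neg (Pro p)"
| "nnf (Neg (Nom i)) = Neg (Nom i)"
| "nnf (Neg (Neg \<phi>)) = nnf \<phi>"
| "nnf (Neg (Con \<phi> \<psi>)) = Dis (nnf (Neg \<phi>)) (nnf (Neg \<psi>))"
| "nnf (Neg (Dis \<phi> \<psi>)) = Con (nnf (Neg \<phi>)) (nnf (Neg \<psi>))"
| "nnf (Neg (Dia \<phi>)) = Box (nnf (Neg \<phi>))"
| "nnf (Neg (Box \<phi>)) = Dia (nnf (Neg \<phi>))"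
| "nnf (Neg (At i \<phi>)) = At i (nnf (Neg \<phi>))"

text \<open>In tableaus, negation always means the negation normal form of the negation.\<close>

abbreviation neg :: "fm \<Rightarrow> fm" where
  "neg \<phi> \<equiv> nnf (Neg \<phi>)"


section \<open>Semantics\<close>

text \<open>The valuation is split into \<open>val\<close> on propositional variables and \<open>den\<close> on nominals;
  the singleton assigned to a nominal \<open>i\<close> is \<open>{den M i}\<close>.\<close>

record 'w model =
  worlds :: "'w set"
  acc :: "('w \<times> 'w) set"
  val :: "pvar \<Rightarrow> 'w set"
  den :: "nom \<Rightarrow> 'w"

definition is_model :: "'w model \<Rightarrow> bool" where
  "is_model M \<longleftrightarrow> worlds M \<noteq> {} \<and> acc M \<subseteq> worlds M \<times> worlds M \<and>
     (\<forall>p. val M p \<subseteq> worlds M) \<and> (\<forall>i. den M i \<in> worlds M)"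

definition spo_model :: "'w model \<Rightarrow> bool" where
  "spo_model M \<longleftrightarrow> is_model M \<and> irrefl (acc M) \<and> trans (acc M)"

fun sat :: "'w model \<Rightarrow> 'w \<Rightarrow> fm \<Rightarrow> bool" where
  "sat M w (Pro p) \<longleftrightarrow> w \<in> val M p"
| "sat M w (Nom i) \<longleftrightarrow> w = den M i"
| "sat M w (Neg \<phi>) \<longleftrightarrow> \<not> sat M w \<phi>"
| "sat M w (Con \<phi> \<psi>) \<longleftrightarrow> sat M w \<phi> \<and> sat M w \<psi>"
| "sat M w (Dis \<phi> \<psi>) \<longleftrightarrow> sat M w \<phi> \<or> sat M w \<psi>"
| "sat M w (Dia \<phi>) \<longleftrightarrow> (\<exists>v. (w, v) \<in> acc M \<and> sat M v \<phi>)"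
| "sat M w (Box \<phi>) \<longleftrightarrow> (\<forall>v. (w, v) \<in> acc M \<longrightarrow> sat M v \<phi>)"
| "sat M w (At i \<phi>) \<longleftrightarrow> sat M (den M i) \<phi>"


section \<open>Branches\<close>

text \<open>
  A finite branch is given by its root formula \<open>r\<close> and the list \<open>\<Theta>\<close> of steps made along it, oldest
  first. A step records the formulas added by one rule application. Applications of the diamond
  rule are tagged: \<open>Witness i \<phi> j\<close> is the application to \<open>At i (Dia \<phi>)\<close> introducing \<open>j\<close>. The tags
  determine which formulas are accessibility formulas and which nominal generated which.
\<close>

datatype step = Add "fm set" | Witness nom fm nom

fun step_fms :: "step \<Rightarrow> fm set" where
  "step_fms (Add A) = A"
| "step_fms (Witness i \<phi> j) = {At i (Dia (Nom j)), At j \<phi>}"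

definition fms :: "fm \<Rightarrow> step list \<Rightarrow> fm set" where
  "fms r \<Theta> = insert r (\<Union>s\<in>set \<Theta>. step_fms s)"

definition branch_noms :: "fm \<Rightarrow> step list \<Rightarrow> nom set" where
  "branch_noms r \<Theta> = (\<Union>\<chi>\<in>fms r \<Theta>. noms \<chi>)"

definition accessibility_fms :: "step list \<Rightarrow> fm set" where
  "accessibility_fms \<Theta> = {At i (Dia (Nom j)) | i j. \<exists>\<phi>. Witness i \<phi> j \<in> set \<Theta>}"

definition closed_fms :: "fm set \<Rightarrow> bool" where
  "closed_fms A \<longleftrightarrow> (\<exists>i \<phi>. At i \<phi> \<in> A \<and> At i (neg \<phi>) \<in> A)"


section \<open>Quasi-urfathers\<close>

definition prefixed_subfm :: "fm \<Rightarrow> fm \<Rightarrow> bool" where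
  "prefixed_subfm \<chi> \<chi>' \<longleftrightarrow> (\<exists>i \<phi> j \<psi>. \<chi> = At i \<phi> \<and> \<chi>' = At j \<psi> \<and> \<phi> \<in> subfms \<psi>)"

definition T1 :: "fm \<Rightarrow> step list \<Rightarrow> nom \<Rightarrow> fm set" where
  "T1 r \<Theta> i = {\<phi>. At i \<phi> \<in> fms r \<Theta> \<and> prefixed_subfm (At i \<phi>) r}"

definition T2 :: "fm \<Rightarrow> step list \<Rightarrow> nom \<Rightarrow> fm set" where
  "T2 r \<Theta> i = {\<psi>. At i \<psi> \<in> fms r \<Theta> \<and>
     (\<exists>j\<in>noms r. prefixed_subfm (At i \<psi>) (At j (Box (Neg (Nom j)))))}"

definition twins :: "fm \<Rightarrow> step list \<Rightarrow> nom \<Rightarrow> nom \<Rightarrow> bool" where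
  "twins r \<Theta> i j \<longleftrightarrow> T1 r \<Theta> i \<union> T2 r \<Theta> i = T1 r \<Theta> j \<union> T2 r \<Theta> j"

definition generates :: "step list \<Rightarrow> (nom \<times> nom) set" where
  "generates \<Theta> = {(i, j). \<exists>\<phi>. Witness i \<phi> j \<in> set \<Theta>}"

definition quasi_urfather :: "fm \<Rightarrow> step list \<Rightarrow> nom \<Rightarrow> bool" where
  "quasi_urfather r \<Theta> i \<longleftrightarrow>
     \<not> (\<exists>j k. j \<noteq> k \<and> twins r \<Theta> j k \<and> (j, i) \<in> (generates \<Theta>)\<^sup>* \<and> (k, i) \<in> (generates \<Theta>)\<^sup>*)"


section \<open>The calculus\<close>

text \<open>\<open>tab_rule r \<Theta> S\<close>: some rule is applicable to the branch \<open>\<Theta>\<close>, and its application replaces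
  \<open>\<Theta>\<close> by the branches \<open>\<Theta> @ [s]\<close> for \<open>s \<in> S\<close>.\<close>

inductive tab_rule :: "fm \<Rightarrow> step list \<Rightarrow> step set \<Rightarrow> bool" for r \<Theta> where
  Eq: "i \<in> branch_noms r \<Theta> \<Longrightarrow> tab_rule r \<Theta> {Add {At i (Nom i)}}"
| Con: "At i (Con \<phi> \<psi>) \<in> fms r \<Theta> \<Longrightarrow> tab_rule r \<Theta> {Add {At i \<phi>, At i \<psi>}}"
| Dis: "At i (Dis \<phi> \<psi>) \<in> fms r \<Theta> \<Longrightarrow> tab_rule r \<Theta> {Add {At i \<phi>}, Add {At i \<psi>}}"
| Dia: "At i (Dia \<phi>) \<in> fms r \<Theta> \<Longrightarrow> At i (Dia \<phi>) \<notin> accessibility_fms \<Theta> \<Longrightarrow>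
    \<nexists>k. Witness i \<phi> k \<in> set \<Theta> \<Longrightarrow> quasi_urfather r \<Theta> i \<Longrightarrow> j \<notin> branch_noms r \<Theta> \<Longrightarrow>
    tab_rule r \<Theta> {Witness i \<phi> j}"
| Box: "At i (Box \<phi>) \<in> fms r \<Theta> \<Longrightarrow> At i (Dia (Nom j)) \<in> fms r \<Theta> \<Longrightarrow>
    tab_rule r \<Theta> {Add {At j \<phi>}}"
| At: "At i (At j \<phi>) \<in> fms r \<Theta> \<Longrightarrow> tab_rule r \<Theta> {Add {At j \<phi>}}"
| Id: "At i \<phi> \<in> fms r \<Theta> \<Longrightarrow> At i \<phi> \<notin> accessibility_fms \<Theta> \<Longrightarrow> At i (Nom j) \<in> fms r \<Theta> \<Longrightarrow>
    tab_rule r \<Theta> {Add {At j \<phi>}}"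
| Irr: "i \<in> branch_noms r \<Theta> \<Longrightarrow> tab_rule r \<Theta> {Add {At i (Box (Neg (Nom i)))}}"
| Trs: "At i (Box \<phi>) \<in> fms r \<Theta> \<Longrightarrow> At i (Dia (Nom j)) \<in> fms r \<Theta> \<Longrightarrow>
    tab_rule r \<Theta> {Add {At j (Box \<phi>)}}"

text \<open>Closed branches are not extended, and every produced branch must gain a formula.\<close>

definition extends_by :: "fm \<Rightarrow> step list \<Rightarrow> step set \<Rightarrow> bool" where
  "extends_by r \<Theta> S \<longleftrightarrow> tab_rule r \<Theta> S \<and> \<not> closed_fms (fms r \<Theta>) \<and>
     (\<forall>s\<in>S. \<not> step_fms s \<subseteq> fms r \<Theta>)"

text \<open>
  A tableau with root formula \<open>At i \<phi>\<close>, possibly infinite, is represented by its set of nodes, each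
  node being identified with the list of steps leading to it from the root node \<open>[]\<close>.
\<close>

definition tableau :: "nom \<Rightarrow> fm \<Rightarrow> step list set \<Rightarrow> bool" where
  "tableau i \<phi> \<T> \<longleftrightarrow> i \<notin> noms \<phi> \<and> [] \<in> \<T> \<and> (\<forall>\<Theta> s. \<Theta> @ [s] \<in> \<T> \<longrightarrow> \<Theta> \<in> \<T>) \<and>
     (\<forall>\<Theta>\<in>\<T>. {s. \<Theta> @ [s] \<in> \<T>} = {} \<or> extends_by (At i \<phi>) \<Theta> {s. \<Theta> @ [s] \<in> \<T>})"

text \<open>The finite or infinite branches of a tableau are the maximal chains of its nodes.\<close>

definition branches :: "step list set \<Rightarrow> step list set set" where
  "branches \<T> = {B. pred_on.maxchain \<T> strict_prefix B}"

definition closed_tableau :: "nom \<Rightarrow> fm \<Rightarrow> step list set \<Rightarrow> bool" where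
  "closed_tableau i \<phi> \<T> \<longleftrightarrow> tableau i \<phi> \<T> \<and>
     (\<forall>B\<in>branches \<T>. closed_fms (\<Union>\<Theta>\<in>B. fms (At i \<phi>) \<Theta>))"

definition provable :: "fm \<Rightarrow> bool" where
  "provable \<phi> \<longleftrightarrow> (\<exists>i \<T>. i \<notin> noms \<phi> \<and> closed_tableau i (neg \<phi>) \<T>)"

end

theory Submission
  imports Defs "HOL-Library.Countable_Set"
begin

text \<open>
  A fair systematic tableau that is not closed has an open branch, and the union \<open>L\<close> of its nodes
  is saturated. Only the types \<open>T k = {\<phi> \<in> Cl. At k \<phi> \<in> L}\<close> of the nominals \<open>k\<close> that are
  quasi-urfathers in the limit are kept: a witness that is not a quasi-urfather is a twin of an
  ancestor that is one. Ordering the types by \<open>t \<lhd> t'\<close> iff \<open>\<psi>, \<box>\<psi> \<in> t'\<close> for all \<open>\<box>\<psi> \<in> t\<close> gives a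
  transitive model of the root formula, in which a type containing a nominal \<open>m\<close> of the root is
  irreflexive, since it contains \<open>\<box>\<not>m\<close> as well. The remaining types are replaced by infinitely many
  copies \<open>(t, 0), (t, 1), \<dots>\<close>, whose indices must increase along the edges within a cluster; this
  makes the model irreflexive without duplicating any named world.
\<close>

section \<open>Formulas and branches\<close>

lemma subfms_refl [simp]: "\<phi> \<in> subfms \<phi>"
  by (cases \<phi>) auto

lemma subfms_trans: "\<chi> \<in> subfms \<phi> \<Longrightarrow> \<phi> \<in> subfms \<psi> \<Longrightarrow> \<chi> \<in> subfms \<psi>"
  by (induction \<psi>) auto

lemma finite_subfms: "finite (subfms \<phi>)"
  by (induction \<phi>) auto

lemma noms_subfms: "\<chi> \<in> subfms \<phi> \<Longrightarrow> noms \<chi> \<subseteq> noms \<phi>"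
  by (induction \<phi>) auto

lemma finite_noms: "finite (noms \<phi>)"
  by (induction \<phi>) auto

lemma noms_nnf: "noms (nnf \<phi>) = noms \<phi>"
  by (induction \<phi> rule: nnf.induct) auto

lemma sat_nnf: "sat M w (nnf \<phi>) \<longleftrightarrow> sat M w \<phi>"
  by (induction \<phi> arbitrary: w rule: nnf.induct) auto

lemma Neg_in_subfms_nnf:
  "Neg \<chi> \<in> subfms (nnf \<phi>) \<Longrightarrow> (\<exists>p. \<chi> = Pro p) \<or> (\<exists>i. \<chi> = Nom i)"
  by (induction \<phi> rule: nnf.induct) auto

lemma fms_Nil [simp]: "fms r [] = {r}"
  by (simp add: fms_def)

lemma fms_snoc: "fms r (\<Theta> @ [s]) = fms r \<Theta> \<union> step_fms s"
  by (auto simp: fms_def)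

lemma root_in_fms: "r \<in> fms r \<Theta>"
  by (simp add: fms_def)

lemma step_fms_subset_fms: "s \<in> set \<Theta> \<Longrightarrow> step_fms s \<subseteq> fms r \<Theta>"
  by (auto simp: fms_def)

lemma noms_subset_branch_noms: "\<phi> \<in> fms r \<Theta> \<Longrightarrow> noms \<phi> \<subseteq> branch_noms r \<Theta>"
  by (auto simp: branch_noms_def)

lemma Witness_branch_noms:
  assumes "Witness i \<phi> j \<in> set \<Theta>"
  shows "i \<in> branch_noms r \<Theta>" "j \<in> branch_noms r \<Theta>"
proof -
  have "At i (Dia (Nom j)) \<in> fms r \<Theta>"
    using step_fms_subset_fms[OF assms, of r] by auto
  from noms_subset_branch_noms[OF this]
  show "i \<in> branch_noms r \<Theta>" "j \<in> branch_noms r \<Theta>" by auto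
qed

lemma closed_fms_mono: "closed_fms A \<Longrightarrow> A \<subseteq> B \<Longrightarrow> closed_fms B"
  by (auto simp: closed_fms_def)

lemma finite_generates: "finite (generates \<Theta>)"
proof -
  have "generates \<Theta> \<subseteq> (\<lambda>s. case s of Witness i \<phi> j \<Rightarrow> (i, j) | _ \<Rightarrow> (0, 0)) ` set \<Theta>"
    by (force simp: generates_def image_iff)
  then show ?thesis
    by (rule finite_subset) simp
qed


section \<open>The systematic tableau\<close>

instance fm :: countable
  by countable_datatype

text \<open>Steps carry arbitrary sets of formulas and so cannot be enumerated; actions use lists,
  which makes them countable. \<open>Generate\<close> omits the new nominal, so that it stays the
  same action while the branch grows and the fresh nominal changes; fairness speaks about such
  persistent actions.\<close>

datatype action = Extend "fm list list" | Generate nom fm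

instance action :: countable
  by countable_datatype

definition fresh :: "fm \<Rightarrow> step list \<Rightarrow> nom" where
  "fresh r \<Theta> = (SOME j. j \<notin> branch_noms r \<Theta>)"

fun outcome :: "fm \<Rightarrow> step list \<Rightarrow> action \<Rightarrow> step set" where
  "outcome r \<Theta> (Extend xss) = (\<lambda>xs. Add (set xs)) ` set xss"
| "outcome r \<Theta> (Generate i \<phi>) = {Witness i \<phi> (fresh r \<Theta>)}"

definition enabled :: "fm \<Rightarrow> step list \<Rightarrow> action \<Rightarrow> bool" where
  "enabled r \<Theta> a \<longleftrightarrow> extends_by r \<Theta> (outcome r \<Theta> a)"

text \<open>Taking the enabled action of least code is a priority rule. It is fair because no action
  is executed twice along a branch.\<close>

definition chosen :: "fm \<Rightarrow> step list \<Rightarrow> action" where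
  "chosen r \<Theta> = (ARG_MIN to_nat a. enabled r \<Theta> a)"

definition successors :: "fm \<Rightarrow> step list \<Rightarrow> step set" where
  "successors r \<Theta> = (if \<exists>a. enabled r \<Theta> a then outcome r \<Theta> (chosen r \<Theta>) else {})"

inductive_set systematic :: "fm \<Rightarrow> step list set" for r where
  root: "[] \<in> systematic r"
| child: "\<Theta> \<in> systematic r \<Longrightarrow> s \<in> successors r \<Theta> \<Longrightarrow> \<Theta> @ [s] \<in> systematic r"

lemma enabled_chosen: "enabled r \<Theta> a \<Longrightarrow> enabled r \<Theta> (chosen r \<Theta>)"
  unfolding chosen_def by (rule arg_min_natI)

lemma chosen_le: "enabled r \<Theta> a \<Longrightarrow> to_nat (chosen r \<Theta>) \<le> to_nat a"
  unfolding chosen_def by (rule arg_min_nat_le)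

lemma tab_rule_nonempty: "tab_rule r \<Theta> S \<Longrightarrow> S \<noteq> {}"
  by (induction rule: tab_rule.induct) auto

lemma successors_nonempty: "enabled r \<Theta> a \<Longrightarrow> successors r \<Theta> \<noteq> {}"
  using enabled_chosen[of r \<Theta> a] tab_rule_nonempty
  by (auto simp: successors_def enabled_def extends_by_def)

lemma tab_rule_WitnessD:
  assumes "tab_rule r \<Theta> {Witness i \<phi> j}"
  shows "\<nexists>k. Witness i \<phi> k \<in> set \<Theta>"
  using assms by (auto elim: tab_rule.cases)

lemma tab_rule_finite:
  assumes "tab_rule r \<Theta> S" "s \<in> S"
  shows "finite (step_fms s)"
  using assms by (induction rule: tab_rule.induct) auto

lemma tab_rule_Witness_fresh:
  assumes "tab_rule r \<Theta> S" "Witness i \<phi> j \<in> S"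
  shows "j \<notin> branch_noms r \<Theta>"
  using assms by (auto elim: tab_rule.cases)

lemma successors_tab_rule:
  "s \<in> successors r \<Theta> \<Longrightarrow> extends_by r \<Theta> (successors r \<Theta>)"
  using enabled_chosen by (force simp: successors_def enabled_def split: if_splits)

lemma systematic_snoc_iff:
  "\<Theta> @ [s] \<in> systematic r \<longleftrightarrow> \<Theta> \<in> systematic r \<and> s \<in> successors r \<Theta>"
  by (auto intro: systematic.child elim: systematic.cases)

lemma tableau_systematic:
  assumes "i \<notin> noms \<phi>"
  shows "tableau i \<phi> (systematic (At i \<phi>))"
  unfolding tableau_def
  using assms successors_tab_rule
  by (auto simp: systematic_snoc_iff intro: systematic.root)

lemma systematic_prefix:
  assumes "\<Theta> @ \<Theta>' \<in> systematic r"
  shows "\<Theta> \<in> systematic r"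
  using assms
  by (induction \<Theta>' rule: rev_induct) (auto simp: systematic_snoc_iff simp flip: append_assoc)

section \<open>Maximal chains of nodes as sequences of stages\<close>

lemma maxchain_memI:
  assumes "pred_on.maxchain A strict_prefix B" "x \<in> A"
    and "\<And>y. y \<in> B \<Longrightarrow> prefix x y \<or> prefix y x"
  shows "x \<in> B"
proof -
  interpret pred_on A strict_prefix .
  have "chain B"
    using assms(1) by (rule maxchain_imp_chain)
  then have "chain (insert x B)"
    using assms(2,3) by (auto simp: chain_def strict_prefix_def)
  then have "\<not> B \<subset> insert x B"
    using assms(1) by (auto simp: maxchain_def)
  then show ?thesis by auto
qed

lemma maxchain_systematic_Nil:
  assumes "pred_on.maxchain (systematic r) strict_prefix B"
  shows "[] \<in> B"
  using assms by (rule maxchain_memI) (auto intro: systematic.root)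

text \<open>If the chain goes beyond \<open>\<Theta>\<close>, the child of \<open>\<Theta>\<close>
  towards a longer member is comparable with every member; otherwise \<open>\<Theta>\<close> is the
  longest member and any child is. Maximality then puts this child into the chain.\<close>

lemma maxchain_systematic_step:
  assumes max: "pred_on.maxchain (systematic r) strict_prefix B"
    and "\<Theta> \<in> B" "successors r \<Theta> \<noteq> {}"
  shows "\<exists>s\<in>successors r \<Theta>. \<Theta> @ [s] \<in> B"
proof -
  interpret pred_on "systematic r" strict_prefix .
  have chain: "chain B"
    using max by (rule maxchain_imp_chain)
  then have sub: "B \<subseteq> systematic r"
    by (auto simp: chain_def)
  have comparable: "prefix x y \<or> prefix y x" if "x \<in> B" "y \<in> B" for x y
    using chain that by (auto simp: chain_def strict_prefix_def)
  show ?thesis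
  proof (cases "\<exists>\<Theta>'\<in>B. strict_prefix \<Theta> \<Theta>'")
    case True
    then obtain s \<Theta>' where \<Theta>': "\<Theta> @ s # \<Theta>' \<in> B"
      by (elim bexE strict_prefixE') blast
    then have node: "\<Theta> @ [s] \<in> systematic r"
      using sub systematic_prefix[of "\<Theta> @ [s]" \<Theta>' r] by auto
    have "\<Theta> @ [s] \<in> B"
    proof (rule maxchain_memI[OF max node])
      fix y assume y: "y \<in> B"
      have "prefix (\<Theta> @ [s]) (\<Theta> @ s # \<Theta>')" by simp
      then show "prefix (\<Theta> @ [s]) y \<or> prefix y (\<Theta> @ [s])"
        using comparable[OF \<Theta>' y] by (meson prefix_order.trans prefix_same_cases)
    qed
    then show ?thesis
      using node by (auto simp: systematic_snoc_iff)
  next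
    case False
    obtain s where s: "s \<in> successors r \<Theta>"
      using assms(3) by blast
    have "\<Theta> @ [s] \<in> systematic r"
      using s assms(2) sub by (auto intro: systematic.child)
    then have "\<Theta> @ [s] \<in> B"
    proof (rule maxchain_memI[OF max])
      fix y assume "y \<in> B"
      then have "prefix y \<Theta>"
        using False comparable[OF assms(2)] by (auto simp: strict_prefix_def)
      then show "prefix (\<Theta> @ [s]) y \<or> prefix y (\<Theta> @ [s])" by simp
    qed
    then show ?thesis
      using s by blast
  qed
qed

text \<open>At a leaf the sequence stays constant, so finite and infinite branches are treated
  alike.\<close>

lemma maxchain_sequence:
  assumes max: "pred_on.maxchain (systematic r) strict_prefix B"
  obtains \<sigma> where "\<sigma> 0 = []" "\<And>n. \<sigma> n \<in> B"
    "\<And>n. (\<exists>s\<in>successors r (\<sigma> n). \<sigma> (Suc n) = \<sigma> n @ [s]) \<or>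
       successors r (\<sigma> n) = {} \<and> \<sigma> (Suc n) = \<sigma> n"
proof -
  have "\<exists>\<sigma>. \<forall>n. (\<sigma> n \<in> B \<and> (n = 0 \<longrightarrow> \<sigma> n = [])) \<and>
    ((\<exists>s\<in>successors r (\<sigma> n). \<sigma> (Suc n) = \<sigma> n @ [s]) \<or> successors r (\<sigma> n) = {} \<and> \<sigma> (Suc n) = \<sigma> n)"
    using maxchain_systematic_Nil[OF max] maxchain_systematic_step[OF max]
    by (intro dependent_nat_choice) blast+
  then show ?thesis
    using that by blast
qed


section \<open>Open systematic branches\<close>

locale open_branch =
  fixes i\<^sub>0 :: nom and \<psi>\<^sub>0 :: fm and \<sigma> :: "nat \<Rightarrow> step list"
  assumes start: "\<sigma> 0 = []"
    and step: "\<And>n. (\<exists>s\<in>successors (At i\<^sub>0 \<psi>\<^sub>0) (\<sigma> n). \<sigma> (Suc n) = \<sigma> n @ [s]) \<or>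
       successors (At i\<^sub>0 \<psi>\<^sub>0) (\<sigma> n) = {} \<and> \<sigma> (Suc n) = \<sigma> n"
    and open_limit: "\<not> closed_fms (\<Union>n. fms (At i\<^sub>0 \<psi>\<^sub>0) (\<sigma> n))"
    and Neg_atomic: "\<And>\<chi>. Neg \<chi> \<in> subfms \<psi>\<^sub>0 \<Longrightarrow> (\<exists>p. \<chi> = Pro p) \<or> (\<exists>i. \<chi> = Nom i)"
begin

abbreviation r :: fm where
  "r \<equiv> At i\<^sub>0 \<psi>\<^sub>0"

definition L :: "fm set" where
  "L = (\<Union>n. fms r (\<sigma> n))"

definition W :: "step set" where
  "W = (\<Union>n. set (\<sigma> n))"

lemma in_L_iff: "\<chi> \<in> L \<longleftrightarrow> (\<exists>n. \<chi> \<in> fms r (\<sigma> n))"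
  by (simp add: L_def)

lemma set_mono: "n \<le> m \<Longrightarrow> set (\<sigma> n) \<subseteq> set (\<sigma> m)"
proof (rule lift_Suc_mono_le)
  show "set (\<sigma> k) \<subseteq> set (\<sigma> (Suc k))" for k
    using step[of k] by auto
qed

lemma fms_mono: "n \<le> m \<Longrightarrow> fms r (\<sigma> n) \<subseteq> fms r (\<sigma> m)"
  using set_mono[of n m] by (auto simp: fms_def)

lemma branch_noms_mono: "n \<le> m \<Longrightarrow> branch_noms r (\<sigma> n) \<subseteq> branch_noms r (\<sigma> m)"
  using fms_mono[of n m] by (auto simp: branch_noms_def)

lemma root_noms: "j \<in> noms r \<Longrightarrow> j \<in> branch_noms r (\<sigma> n)"
  using noms_subset_branch_noms[OF root_in_fms] by blast

lemma open_stage: "\<not> closed_fms (fms r (\<sigma> n))"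
proof
  assume "closed_fms (fms r (\<sigma> n))"
  then have "closed_fms (\<Union>n. fms r (\<sigma> n))"
    by (rule closed_fms_mono) auto
  then show False
    using open_limit by contradiction
qed

lemma finite_fms: "finite (fms r (\<sigma> n))"
proof (induction n)
  case 0
  then show ?case by (simp add: start)
next
  case (Suc n)
  then show ?case
    using step[of n] successors_tab_rule tab_rule_finite unfolding extends_by_def
    by (metis fms_snoc finite_UnI)
qed

lemma fresh_notin: "fresh r (\<sigma> n) \<notin> branch_noms r (\<sigma> n)"
proof -
  have "finite (branch_noms r (\<sigma> n))"
    using finite_fms by (simp add: branch_noms_def finite_noms)
  then show ?thesis
    unfolding fresh_def by (metis ex_new_if_finite infinite_UNIV_nat someI_ex)
qed

text \<open>The step taken remains on all later stages. For \<open>Extend\<close>, one of the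
  produced branches would then gain no formula; for \<open>Generate\<close>, the diamond rule has
  already been applied to that formula.\<close>

lemma chosen_disabled:
  assumes "enabled r (\<sigma> n) a" "n < m"
  shows "\<not> enabled r (\<sigma> m) (chosen r (\<sigma> n))"
proof -
  have succ: "successors r (\<sigma> n) = outcome r (\<sigma> n) (chosen r (\<sigma> n))"
    using assms(1) by (auto simp: successors_def)
  obtain s where s: "s \<in> successors r (\<sigma> n)" "\<sigma> (Suc n) = \<sigma> n @ [s]"
    using step[of n] successors_nonempty[OF assms(1)] by auto
  then have "s \<in> set (\<sigma> m)"
    using set_mono[of "Suc n" m] assms(2) by auto
  then show ?thesis
    using s(1) step_fms_subset_fms[of s "\<sigma> m" r] unfolding succ
    by (cases "chosen r (\<sigma> n)") (auto simp: enabled_def extends_by_def dest: tab_rule_WitnessD)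
qed

text \<open>Pigeonhole: from stage \<open>n\<close> on, the chosen actions would be pairwise
  distinct, an earlier one being disabled when a later one is chosen, yet all their codes are
  bounded by that of \<open>a\<close>.\<close>

lemma fairness:
  assumes "\<And>m. n \<le> m \<Longrightarrow> enabled r (\<sigma> m) a"
  shows False
proof -
  let ?c = "\<lambda>m. to_nat (chosen r (\<sigma> m))"
  have "?c m \<noteq> ?c m'" if "n \<le> m" "m < m'" for m m'
    using chosen_disabled[OF assms[OF that(1)] that(2)] enabled_chosen[OF assms[of m']] that
    by auto
  then have "inj_on ?c {n..}"
    by (intro linorder_inj_onI) auto
  moreover have "?c ` {n..} \<subseteq> {..to_nat a}"
    using chosen_le[OF assms] by auto
  ultimately have "finite {n..}"
    by (meson finite_atMost inj_on_finite)
  then show False by (simp add: infinite_Ici)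
qed

text \<open>If no alternative were contained in \<open>L\<close>, none would be contained in any
  stage, so the application would be non-redundant at every stage from \<open>n\<close> on, against
  fairness.\<close>

lemma saturated:
  assumes "\<And>m. n \<le> m \<Longrightarrow> tab_rule r (\<sigma> m) ((\<lambda>xs. Add (set xs)) ` set xss)"
  shows "\<exists>xs\<in>set xss. set xs \<subseteq> L"
proof (rule ccontr)
  assume "\<not> ?thesis"
  then have "enabled r (\<sigma> m) (Extend xss)" if "n \<le> m" for m
    using assms[OF that] open_stage by (fastforce simp: enabled_def extends_by_def L_def)
  then show False
    by (rule fairness)
qed

lemma saturated_Add:
  assumes "finite A" "\<And>m. n \<le> m \<Longrightarrow> tab_rule r (\<sigma> m) {Add A}"
  shows "A \<subseteq> L"
proof -
  obtain xs where "A = set xs"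
    using finite_list[OF assms(1)] by blast
  then show ?thesis
    using saturated[of n "[xs]"] assms(2) by simp
qed

section \<open>Closure of the limit under the rules\<close>

lemma L_stage:
  assumes "\<phi> \<in> L"
  obtains n where "\<And>m. n \<le> m \<Longrightarrow> \<phi> \<in> fms r (\<sigma> m)"
  using assms fms_mono unfolding in_L_iff by blast

lemma L_stage2:
  assumes "\<phi> \<in> L" "\<psi> \<in> L"
  obtains n where "\<And>m. n \<le> m \<Longrightarrow> \<phi> \<in> fms r (\<sigma> m) \<and> \<psi> \<in> fms r (\<sigma> m)"
proof -
  obtain a where a: "\<And>m. a \<le> m \<Longrightarrow> \<phi> \<in> fms r (\<sigma> m)"
    using L_stage[OF assms(1)] by blast
  obtain b where b: "\<And>m. b \<le> m \<Longrightarrow> \<psi> \<in> fms r (\<sigma> m)"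
    using L_stage[OF assms(2)] by blast
  show ?thesis
    by (rule that[of "max a b"]) (simp add: a b)
qed

lemma Con_L:
  assumes "At i (Con \<phi> \<psi>) \<in> L"
  shows "At i \<phi> \<in> L" "At i \<psi> \<in> L"
proof -
  obtain n where n: "\<And>m. n \<le> m \<Longrightarrow> At i (Con \<phi> \<psi>) \<in> fms r (\<sigma> m)"
    using L_stage[OF assms] by blast
  have "{At i \<phi>, At i \<psi>} \<subseteq> L"
    by (rule saturated_Add[of _ n]) (use n in \<open>auto intro: tab_rule.Con\<close>)
  then show "At i \<phi> \<in> L" "At i \<psi> \<in> L" by auto
qed

lemma Dis_L:
  assumes "At i (Dis \<phi> \<psi>) \<in> L"
  shows "At i \<phi> \<in> L \<or> At i \<psi> \<in> L"
proof -
  obtain n where n: "\<And>m. n \<le> m \<Longrightarrow> At i (Dis \<phi> \<psi>) \<in> fms r (\<sigma> m)"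
    using L_stage[OF assms] by blast
  have "tab_rule r (\<sigma> m) {Add {At i \<phi>}, Add {At i \<psi>}}" if "n \<le> m" for m
    using n[OF that] by (auto intro: tab_rule.Dis)
  then show ?thesis
    using saturated[of n "[[At i \<phi>], [At i \<psi>]]"] by auto
qed

lemma Box_L:
  assumes "At i (Box \<phi>) \<in> L" "At i (Dia (Nom j)) \<in> L"
  shows "At j \<phi> \<in> L" "At j (Box \<phi>) \<in> L"
proof -
  obtain n where n: "\<And>m. n \<le> m \<Longrightarrow> At i (Box \<phi>) \<in> fms r (\<sigma> m) \<and> At i (Dia (Nom j)) \<in> fms r (\<sigma> m)"
    using L_stage2[OF assms] by blast
  have "{At j \<phi>} \<subseteq> L"
    by (rule saturated_Add[of _ n]) (use n in \<open>auto intro: tab_rule.Box\<close>)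
  then show "At j \<phi> \<in> L" by simp
  have "{At j (Box \<phi>)} \<subseteq> L"
    by (rule saturated_Add[of _ n]) (use n in \<open>auto intro: tab_rule.Trs\<close>)
  then show "At j (Box \<phi>) \<in> L" by simp
qed

lemma At_L:
  assumes "At i (At j \<phi>) \<in> L"
  shows "At j \<phi> \<in> L"
proof -
  obtain n where n: "\<And>m. n \<le> m \<Longrightarrow> At i (At j \<phi>) \<in> fms r (\<sigma> m)"
    using L_stage[OF assms] by blast
  have "{At j \<phi>} \<subseteq> L"
    by (rule saturated_Add[of _ n]) (use n in \<open>auto intro: tab_rule.At\<close>)
  then show ?thesis by simp
qed

text \<open>Being an accessibility formula depends on the stage, and saturation needs the rule to be
  applicable at all late stages; hence the side condition is assumed for every stage.\<close>

lemma Id_L: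
  assumes "At i \<phi> \<in> L" "At i (Nom j) \<in> L" and acc: "\<And>n. At i \<phi> \<notin> accessibility_fms (\<sigma> n)"
  shows "At j \<phi> \<in> L"
proof -
  obtain n where n: "\<And>m. n \<le> m \<Longrightarrow> At i \<phi> \<in> fms r (\<sigma> m) \<and> At i (Nom j) \<in> fms r (\<sigma> m)"
    using L_stage2[OF assms(1,2)] by blast
  have "{At j \<phi>} \<subseteq> L"
    by (rule saturated_Add[of _ n]) (use n acc in \<open>auto intro: tab_rule.Id\<close>)
  then show ?thesis by simp
qed

lemma Eq_Irr_L:
  assumes "i \<in> branch_noms r (\<sigma> n)"
  shows "At i (Nom i) \<in> L" "At i (Box (Neg (Nom i))) \<in> L"
proof -
  have n: "i \<in> branch_noms r (\<sigma> m)" if "n \<le> m" for m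
    using branch_noms_mono[OF that] assms by auto
  have "{At i (Nom i)} \<subseteq> L"
    by (rule saturated_Add[of _ n]) (use n in \<open>auto intro: tab_rule.Eq\<close>)
  then show "At i (Nom i) \<in> L" by simp
  have "{At i (Box (Neg (Nom i)))} \<subseteq> L"
    by (rule saturated_Add[of _ n]) (use n in \<open>auto intro: tab_rule.Irr\<close>)
  then show "At i (Box (Neg (Nom i))) \<in> L" by simp
qed

section \<open>The forest of generated nominals\<close>

lemma Witness_introduced:
  assumes "Witness i \<phi> j \<in> W"
  obtains n where "\<sigma> (Suc n) = \<sigma> n @ [Witness i \<phi> j]" "j \<notin> branch_noms r (\<sigma> n)"
proof -
  have "\<exists>n. \<sigma> (Suc n) = \<sigma> n @ [Witness i \<phi> j] \<and> j \<notin> branch_noms r (\<sigma> n)"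
    if "Witness i \<phi> j \<in> set (\<sigma> m)" for m
    using that
  proof (induction m)
    case 0
    then show ?case by (simp add: start)
  next
    case (Suc m)
    show ?case
    proof (cases "Witness i \<phi> j \<in> set (\<sigma> m)")
      case True
      then show ?thesis by (rule Suc.IH)
    next
      case False
      with Suc.prems step[of m]
      have s: "Witness i \<phi> j \<in> successors r (\<sigma> m)" "\<sigma> (Suc m) = \<sigma> m @ [Witness i \<phi> j]"
        by auto
      then show ?thesis
        using successors_tab_rule[OF s(1)] tab_rule_Witness_fresh
        by (auto simp: extends_by_def)
    qed
  qed
  then show ?thesis
    using assms that by (auto simp: W_def)
qed

text \<open>A witness is fresh when introduced, so a stage on which it occurs cannot precede its
  introduction.\<close>

lemma Witness_at_stage:
  assumes "Witness i \<phi> j \<in> W" "j \<in> branch_noms r (\<sigma> m)"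
  shows "Witness i \<phi> j \<in> set (\<sigma> m)"
proof -
  obtain n where n: "\<sigma> (Suc n) = \<sigma> n @ [Witness i \<phi> j]" "j \<notin> branch_noms r (\<sigma> n)"
    using Witness_introduced[OF assms(1)] by blast
  then have "Suc n \<le> m"
    using branch_noms_mono[of m n] assms(2) by (meson not_less_eq_eq subsetD)
  then show ?thesis
    using set_mono[of "Suc n" m] n(1) by auto
qed

text \<open>When \<open>j\<close> is first introduced, both steps must be present, but the earlier
  stage does not mention \<open>j\<close>; so both are the last step.\<close>

lemma Witness_unique_parent:
  assumes "Witness i \<phi> j \<in> W" "Witness i' \<phi>' j \<in> W"
  shows "i = i'"
proof -
  obtain n where n: "\<sigma> (Suc n) = \<sigma> n @ [Witness i \<phi> j]" "j \<notin> branch_noms r (\<sigma> n)"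
    using Witness_introduced[OF assms(1)] by blast
  have "j \<in> branch_noms r (\<sigma> (Suc n))"
    using Witness_branch_noms(2)[of i \<phi> j] n(1) by simp
  then have "Witness i' \<phi>' j \<in> set (\<sigma> (Suc n))"
    using Witness_at_stage assms(2) by blast
  then show ?thesis
    using n Witness_branch_noms(2) by auto
qed

lemma Witness_not_root:
  assumes "Witness i \<phi> j \<in> W"
  shows "j \<notin> noms r"
  using assms root_noms by (metis Witness_introduced)

lemma Witness_L:
  assumes "Witness i \<phi> j \<in> W"
  shows "At i (Dia (Nom j)) \<in> L" "At j \<phi> \<in> L"
proof -
  obtain n where "Witness i \<phi> j \<in> set (\<sigma> n)"
    using assms by (auto simp: W_def)
  then show "At i (Dia (Nom j)) \<in> L" "At j \<phi> \<in> L"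
    using step_fms_subset_fms[of "Witness i \<phi> j" "\<sigma> n" r] by (auto simp: in_L_iff)
qed


section \<open>Types and quasi-urfathers in the limit\<close>

text \<open>The finite pool from which \<open>T1\<close> and \<open>T2\<close> are drawn, uniformly
  in the nominal and the stage; \<open>T\<close> is accordingly the limit of the sets compared by
  \<open>twins\<close>.\<close>

definition Cl :: "fm set" where
  "Cl = subfms \<psi>\<^sub>0 \<union> (\<Union>j\<in>noms r. subfms (Box (Neg (Nom j))))"

definition T :: "nom \<Rightarrow> fm set" where
  "T k = {\<phi> \<in> Cl. At k \<phi> \<in> L}"

definition G :: "(nom \<times> nom) set" where
  "G = {(i, j). \<exists>\<phi>. Witness i \<phi> j \<in> W}"

text \<open>Quasi-urfathers of the limit: \<open>T\<close> is injective on the ancestors of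
  \<open>k\<close>, with \<open>k\<close> counted among them.\<close>

definition U :: "nom set" where
  "U = {k. \<forall>i j. (i, k) \<in> G\<^sup>* \<longrightarrow> (j, k) \<in> G\<^sup>* \<longrightarrow> T i = T j \<longrightarrow> i = j}"

lemma Cl_subfms: "\<phi> \<in> Cl \<Longrightarrow> \<chi> \<in> subfms \<phi> \<Longrightarrow> \<chi> \<in> Cl"
  unfolding Cl_def using subfms_trans by blast

lemma T_subset_Cl: "\<phi> \<in> T k \<Longrightarrow> \<phi> \<in> Cl"
  by (simp add: T_def)

lemma finite_Cl: "finite Cl"
  unfolding Cl_def using finite_subfms finite_noms by blast

lemma noms_Cl: "\<phi> \<in> Cl \<Longrightarrow> noms \<phi> \<subseteq> noms r"
  unfolding Cl_def using noms_subfms by fastforce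

lemma Neg_Cl: "Neg \<chi> \<in> Cl \<Longrightarrow> (\<exists>p. \<chi> = Pro p) \<or> (\<exists>i. \<chi> = Nom i)"
  unfolding Cl_def using Neg_atomic by auto

text \<open>Accessibility formulas mention a generated nominal behind the diamond, whereas members
  of \<open>Cl\<close> mention only nominals of the root. This discharges the side conditions of the
  diamond and identity rules.\<close>

lemma Cl_not_accessibility:
  assumes "\<phi> \<in> Cl"
  shows "At i \<phi> \<notin> accessibility_fms (\<sigma> n)"
  using noms_Cl[OF assms] Witness_not_root by (fastforce simp: accessibility_fms_def W_def)

lemma T_stage:
  "T1 r \<Theta> k \<union> T2 r \<Theta> k = {\<phi> \<in> Cl. At k \<phi> \<in> fms r \<Theta>}"
  by (auto simp: T1_def T2_def Cl_def prefixed_subfm_def)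

lemma T_not_contradictory: "\<phi> \<in> T k \<Longrightarrow> neg \<phi> \<notin> T k"
  using open_limit by (auto simp: T_def L_def closed_fms_def)

lemma T_eq_if_Nom:
  assumes "At k (Nom m) \<in> L"
  shows "T k = T m"
proof -
  obtain n where "At k (Nom m) \<in> fms r (\<sigma> n)"
    using assms by (auto simp: in_L_iff)
  then have "k \<in> branch_noms r (\<sigma> n)"
    using noms_subset_branch_noms by fastforce
  then have "At k (Nom k) \<in> L"
    by (rule Eq_Irr_L)
  \<comment> \<open>Identity applied to \<open>At k (Nom k)\<close> along
    \<open>At k (Nom m)\<close> gives symmetry, after which formulas of \<open>Cl\<close> can be
    copied in both directions.\<close>
  then have "At m (Nom k) \<in> L"
    using Id_L[OF _ assms] by (auto simp: accessibility_fms_def)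
  then show ?thesis
    using assms Id_L Cl_not_accessibility unfolding T_def by blast
qed

lemma Nom_in_T:
  assumes "Nom m \<in> T k"
  shows "m \<in> noms r" "T k = T m"
  using noms_Cl[OF T_subset_Cl[OF assms]] assms T_eq_if_Nom by (auto simp: T_def)

lemma root_T:
  assumes "m \<in> noms r"
  shows "Nom m \<in> T m" "Box (Neg (Nom m)) \<in> T m"
  using Eq_Irr_L[OF root_noms[OF assms]] assms by (auto simp: T_def Cl_def)

section \<open>Passing between finite stages and the limit\<close>

lemma G_at_stage:
  assumes "(i, k) \<in> G\<^sup>*" "k \<in> branch_noms r (\<sigma> n)"
  shows "(i, k) \<in> (generates (\<sigma> n))\<^sup>*"
proof -
  have "(i, k) \<in> (generates (\<sigma> n))\<^sup>* \<and> i \<in> branch_noms r (\<sigma> n)"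
    using assms
  proof (induction rule: converse_rtrancl_induct)
    case base
    then show ?case by simp
  next
    case (step i j)
    then obtain \<phi> where "Witness i \<phi> j \<in> W" "j \<in> branch_noms r (\<sigma> n)"
      by (auto simp: G_def)
    then have "Witness i \<phi> j \<in> set (\<sigma> n)"
      by (rule Witness_at_stage)
    then have "(i, j) \<in> generates (\<sigma> n)" "i \<in> branch_noms r (\<sigma> n)"
      using Witness_branch_noms(1) by (auto simp: generates_def)
    then show ?case
      using step by (auto intro: converse_rtrancl_into_rtrancl)
  qed
  then show ?thesis ..
qed

text \<open>All ancestors of \<open>k\<close> are introduced no later than \<open>k\<close>, hence
  within one finite stage. This is what allows the types of all of them to be stable from a common
  stage on.\<close>

lemma finite_ancestors:
  assumes "k \<in> branch_noms r (\<sigma> n)"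
  shows "finite {i. (i, k) \<in> G\<^sup>*}"
proof -
  let ?E = "generates (\<sigma> n)"
  have "{i. (i, k) \<in> G\<^sup>*} \<subseteq> insert k (Domain ?E)"
    using G_at_stage[OF _ assms] by (auto elim: converse_rtranclE)
  then show ?thesis
    by (rule finite_subset) (simp add: finite_generates finite_Domain)
qed

lemma T_stable:
  shows "\<exists>n. \<forall>m\<ge>n. T1 r (\<sigma> m) k \<union> T2 r (\<sigma> m) k = T k"
proof -
  have "\<exists>n. \<forall>\<phi>\<in>A. At k \<phi> \<in> fms r (\<sigma> n)" if "finite A" "A \<subseteq> T k" for A
    using that
  proof (induction A)
    case empty
    then show ?case by simp
  next
    case (insert \<phi> A)
    then obtain n m where "\<forall>\<phi>\<in>A. At k \<phi> \<in> fms r (\<sigma> n)" "At k \<phi> \<in> fms r (\<sigma> m)"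
      by (auto simp: T_def in_L_iff)
    then have "\<forall>\<phi>\<in>insert \<phi> A. At k \<phi> \<in> fms r (\<sigma> (max n m))"
      using fms_mono[of n "max n m"] fms_mono[of m "max n m"] by auto
    then show ?case ..
  qed
  moreover have "finite (T k)"
    using finite_Cl by (auto simp: T_def)
  ultimately obtain n where n: "\<forall>\<phi>\<in>T k. At k \<phi> \<in> fms r (\<sigma> n)"
    by blast
  have "T1 r (\<sigma> m) k \<union> T2 r (\<sigma> m) k = T k" if "n \<le> m" for m
    unfolding T_stage using n fms_mono[OF that] by (auto simp: T_def in_L_iff)
  then show ?thesis
    by blast
qed

text \<open>Once the types of the finitely many ancestors of \<open>k\<close> have reached their
  limits, twins among them at a stage are twins in the limit, which \<open>U\<close>
  excludes.\<close>

lemma U_eventually_quasi_urfather: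
  assumes "k \<in> U" "k \<in> branch_noms r (\<sigma> n\<^sub>0)"
  obtains n where "\<And>m. n \<le> m \<Longrightarrow> quasi_urfather r (\<sigma> m) k"
proof -
  let ?A = "{i. (i, k) \<in> G\<^sup>*}"
  obtain f where f: "\<And>i m. f i \<le> m \<Longrightarrow> T1 r (\<sigma> m) i \<union> T2 r (\<sigma> m) i = T i"
    using T_stable by metis
  have fin: "finite (f ` ?A)"
    using finite_ancestors[OF assms(2)] by simp
  have "quasi_urfather r (\<sigma> m) k" if "Max (f ` ?A) \<le> m" for m
  proof -
    have "generates (\<sigma> m) \<subseteq> G"
      by (auto simp: generates_def G_def W_def)
    then have anc: "(i, k) \<in> G\<^sup>*" if "(i, k) \<in> (generates (\<sigma> m))\<^sup>*" for i
      using that rtrancl_mono by blast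
    moreover have "T1 r (\<sigma> m) i \<union> T2 r (\<sigma> m) i = T i" if "(i, k) \<in> G\<^sup>*" for i
    proof (rule f)
      have "f i \<le> Max (f ` ?A)"
        using fin that by (intro Max_ge) auto
      then show "f i \<le> m"
        using \<open>Max (f ` ?A) \<le> m\<close> by simp
    qed
    ultimately show ?thesis
      using assms(1) unfolding quasi_urfather_def twins_def U_def by auto
  qed
  then show ?thesis
    by (rule that)
qed

text \<open>Without a witness, \<open>Generate k \<phi>\<close> would be enabled at all late stages:
  restriction (D) is eventually met because \<open>k\<close> is in \<open>U\<close>.\<close>

lemma Dia_witness:
  assumes "k \<in> U" "Dia \<phi> \<in> T k"
  obtains i where "Witness k \<phi> i \<in> W"
proof -
  have "\<exists>i. Witness k \<phi> i \<in> W"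
  proof (rule ccontr)
    assume none: "\<not> ?thesis"
    obtain n where n: "At k (Dia \<phi>) \<in> fms r (\<sigma> n)"
      using assms(2) by (auto simp: T_def in_L_iff)
    then have "k \<in> branch_noms r (\<sigma> n)"
      using noms_subset_branch_noms by fastforce
    then obtain n' where n': "\<And>m. n' \<le> m \<Longrightarrow> quasi_urfather r (\<sigma> m) k"
      using U_eventually_quasi_urfather[OF assms(1)] by blast
    have "enabled r (\<sigma> m) (Generate k \<phi>)" if "max n n' \<le> m" for m
    proof -
      have "tab_rule r (\<sigma> m) {Witness k \<phi> (fresh r (\<sigma> m))}"
      proof (rule tab_rule.Dia)
        show "At k (Dia \<phi>) \<in> fms r (\<sigma> m)"
          using n fms_mono[of n m] that by auto
        show "At k (Dia \<phi>) \<notin> accessibility_fms (\<sigma> m)"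
          by (rule Cl_not_accessibility[OF T_subset_Cl[OF assms(2)]])
        show "\<nexists>j. Witness k \<phi> j \<in> set (\<sigma> m)"
          using none by (auto simp: W_def)
        show "quasi_urfather r (\<sigma> m) k"
          using n' that by simp
      qed (rule fresh_notin)
      \<comment> \<open>The new nominal makes the application non-redundant, even if its other
        conclusion should be present already.\<close>
      moreover have "At k (Dia (Nom (fresh r (\<sigma> m)))) \<notin> fms r (\<sigma> m)"
        using fresh_notin noms_subset_branch_noms by fastforce
      ultimately show ?thesis
        using open_stage by (simp add: enabled_def extends_by_def)
    qed
    then show False
      by (rule fairness)
  qed
  then show ?thesis
    using that by blast
qed

lemma U_ancestor: "(i, k) \<in> G\<^sup>* \<Longrightarrow> k \<in> U \<Longrightarrow> i \<in> U"
  unfolding U_def by (blast intro: rtrancl_trans)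

lemma root_U:
  assumes "m \<in> noms r"
  shows "m \<in> U"
proof -
  have "i = m" if "(i, m) \<in> G\<^sup>*" for i
    using that assms Witness_not_root by (cases rule: rtranclE) (auto simp: G_def)
  then show ?thesis
    by (auto simp: U_def)
qed

text \<open>If \<open>i\<close> is not in \<open>U\<close>, two of its ancestors are twins. The
  ancestors of \<open>k\<close> have distinct types, so one twin is \<open>i\<close> itself and the
  other is an ancestor of \<open>k\<close>, hence in \<open>U\<close>.\<close>

lemma Witness_T_in_U:
  assumes "k \<in> U" "Witness k \<phi> i \<in> W"
  shows "T i \<in> T ` U"
proof (cases "i \<in> U")
  case False
  then obtain j l where jl: "(j, i) \<in> G\<^sup>*" "(l, i) \<in> G\<^sup>*" "T j = T l" "j \<noteq> l"
    by (auto simp: U_def)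
  \<comment> \<open>A proper ancestor of \<open>i\<close> reaches it through its unique parent
    \<open>k\<close>.\<close>
  have up: "(a, k) \<in> G\<^sup>*" if "(a, i) \<in> G\<^sup>*" "a \<noteq> i" for a
  proof -
    from that obtain b where "(a, b) \<in> G\<^sup>*" "(b, i) \<in> G"
      by (auto elim: rtranclE)
    then show ?thesis
      using Witness_unique_parent[OF assms(2)] by (auto simp: G_def)
  qed
  have "\<exists>a\<in>U. T a = T i"
    using jl up U_ancestor[OF _ assms(1)] assms(1) unfolding U_def
    by (smt (verit) mem_Collect_eq)
  then show ?thesis
    by (metis imageI)
qed simp


section \<open>The model\<close>

definition below :: "fm set \<Rightarrow> fm set \<Rightarrow> bool" (infix "\<lhd>" 50) where
  "t \<lhd> t' \<longleftrightarrow> (\<forall>\<psi>. Box \<psi> \<in> t \<longrightarrow> \<psi> \<in> t' \<and> Box \<psi> \<in> t')"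

definition Worlds :: "(fm set \<times> nat) set" where
  "Worlds = {(t, n). t \<in> T ` U \<and> ((\<exists>m. Nom m \<in> t) \<longrightarrow> n = 0)}"

text \<open>Two types lie in one cluster when each is below the other; only there must an edge raise
  the index. Nominals outside the root do not occur in \<open>Cl\<close> and receive the world of
  \<open>i\<^sub>0\<close> as a default.\<close>

definition M :: "(fm set \<times> nat) model" where
  "M = \<lparr>worlds = Worlds,
     acc = {((t, n), (t', n')) | t n t' n'.
       (t, n) \<in> Worlds \<and> (t', n') \<in> Worlds \<and> t \<lhd> t' \<and> (t' \<lhd> t \<longrightarrow> n < n')},
     val = (\<lambda>p. {(t, n) \<in> Worlds. Pro p \<in> t}),
     den = (\<lambda>i. (T (if i \<in> noms r then i else i\<^sub>0), 0))\<rparr>"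

lemma below_trans: "t \<lhd> t' \<Longrightarrow> t' \<lhd> t'' \<Longrightarrow> t \<lhd> t''"
  by (auto simp: below_def)

lemma Witness_below:
  assumes "Witness k \<phi> i \<in> W"
  shows "T k \<lhd> T i"
proof -
  have "\<psi> \<in> Cl" if "Box \<psi> \<in> Cl" for \<psi>
    using Cl_subfms[OF that, of \<psi>] by simp
  then show ?thesis
    using Box_L[OF _ Witness_L(1)[OF assms]] by (auto simp: below_def T_def)
qed

text \<open>\<open>T k\<close> equals \<open>T m\<close> and so contains
  \<open>\<box>\<not>m\<close>; a loop would put \<open>\<not>m\<close> next to \<open>m\<close>.
  Consequently no cluster with a loop contains a named type.\<close>

lemma named_irreflexive:
  assumes "Nom m \<in> T k"
  shows "\<not> T k \<lhd> T k"
proof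
  assume "T k \<lhd> T k"
  then have "Neg (Nom m) \<in> T k"
    using root_T(2)[OF Nom_in_T(1)[OF assms]] Nom_in_T(2)[OF assms] by (auto simp: below_def)
  then show False
    using T_not_contradictory[OF assms] by simp
qed

lemma root_world: "m \<in> noms r \<Longrightarrow> (T m, 0) \<in> Worlds"
  using root_U[of m] root_T(1)[of m] by (auto simp: Worlds_def)

lemma spo_model_M: "spo_model M"
proof -
  have "(T i\<^sub>0, 0) \<in> Worlds"
    by (rule root_world) simp
  then have "is_model M"
    using root_world by (auto simp: is_model_def M_def)
  moreover have "irrefl (acc M)"
    by (auto simp: irrefl_def M_def)
  \<comment> \<open>If the last type is below the first, all three lie in one cluster, so both edges
    raise the index and so does their composition.\<close>
  moreover have "trans (acc M)"
    unfolding trans_def M_def using below_trans by simp (meson less_trans)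
  ultimately show ?thesis
    by (simp add: spo_model_def)
qed

lemma sat_M:
  assumes "(t, n) \<in> Worlds" "\<phi> \<in> t"
  shows "sat M (t, n) \<phi>"
  using assms
proof (induction \<phi> arbitrary: t n)
  case (Pro p)
  then show ?case by (simp add: M_def)
next
  case (Nom m)
  then obtain k where "t = T k" "n = 0"
    by (auto simp: Worlds_def)
  then show ?case
    using Nom Nom_in_T[of m k] by (simp add: M_def)
next
  case (Neg \<phi>)
  then obtain k where t: "t = T k"
    by (auto simp: Worlds_def)
  from Neg.prems t consider p where "\<phi> = Pro p" | m where "\<phi> = Nom m"
    using Neg_Cl T_subset_Cl by blast
  then show ?case
  proof cases
    case 1
    then show ?thesis
      using Neg.prems T_not_contradictory[of "Pro p" k] t by (auto simp: M_def)
  next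
    case (2 m)
    then have m: "m \<in> noms r"
      using Neg.prems noms_Cl[OF T_subset_Cl, of "Neg \<phi>" k] t by auto
    \<comment> \<open>The nominal \<open>m\<close> denotes \<open>(T m, 0)\<close>, and
      \<open>T m\<close> contains \<open>m\<close>; hence a type containing \<open>\<not>m\<close>
      differs from \<open>T m\<close>.\<close>
    have "Neg (Nom m) \<notin> T m"
      using T_not_contradictory[OF root_T(1)[OF m]] by simp
    then show ?thesis
      using 2 Neg.prems m by (auto simp: M_def)
  qed
next
  case (Con \<phi> \<psi>)
  then obtain k where t: "t = T k"
    by (auto simp: Worlds_def)
  then have "\<phi> \<in> t" "\<psi> \<in> t"
    using Con.prems Con_L[of k \<phi> \<psi>] Cl_subfms[of "Con \<phi> \<psi>"] by (auto simp: T_def)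
  then show ?case
    using Con by simp
next
  case (Dis \<phi> \<psi>)
  then obtain k where t: "t = T k"
    by (auto simp: Worlds_def)
  then have "\<phi> \<in> t \<or> \<psi> \<in> t"
    using Dis.prems Dis_L[of k \<phi> \<psi>] Cl_subfms[of "Dis \<phi> \<psi>"] by (auto simp: T_def)
  then show ?case
    using Dis by auto
next
  case (Dia \<phi>)
  then obtain k where k: "k \<in> U" "t = T k"
    by (auto simp: Worlds_def)
  then obtain i where i: "Witness k \<phi> i \<in> W"
    using Dia_witness Dia.prems by blast
  have \<phi>: "\<phi> \<in> T i"
    using Witness_L(2)[OF i] Dia.prems k Cl_subfms[of "Dia \<phi>" \<phi>] by (auto simp: T_def)
  have below: "t \<lhd> T i"
    using Witness_below[OF i] k by simp
  \<comment> \<open>An unnamed successor is taken one copy higher, which is allowed inside and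
    outside the cluster of \<open>t\<close>. A named one exists only with index 0.\<close>
  define n' where "n' = (if \<exists>m. Nom m \<in> T i then 0 else Suc n)"
  have world: "(T i, n') \<in> Worlds"
    using Witness_T_in_U[OF k(1) i] by (auto simp: Worlds_def n'_def)
  \<comment> \<open>An edge back to \<open>t\<close> would make \<open>T i\<close> below itself, so
    \<open>T i\<close> is unnamed and \<open>n'\<close> is \<open>Suc n\<close>.\<close>
  have "n < n'" if "T i \<lhd> t"
    using named_irreflexive below_trans[OF that below] by (auto simp: n'_def)
  then have "((t, n), (T i, n')) \<in> acc M"
    using below world Dia.prems by (auto simp: M_def)
  then show ?case
    using Dia.IH[OF world \<phi>] by auto
next
  case (Box \<phi>)
  have "sat M (t', n') \<phi>" if "((t, n), (t', n')) \<in> acc M" for t' n'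
    using that Box by (auto simp: M_def below_def)
  then show ?case by auto
next
  case (At m \<phi>)
  then obtain k where t: "t = T k"
    by (auto simp: Worlds_def)
  have m: "m \<in> noms r"
    using At.prems noms_Cl[OF T_subset_Cl, of "At m \<phi>" k] t by auto
  have "\<phi> \<in> T m"
    using At.prems At_L[of k m \<phi>] Cl_subfms[of "At m \<phi>"] t by (auto simp: T_def)
  then have "sat M (T m, 0) \<phi>"
    using At.IH root_world[OF m] by blast
  then show ?case
    using m by (simp add: M_def)
qed

lemma root_satisfied:
  "(T i\<^sub>0, 0) \<in> worlds M" "sat M (T i\<^sub>0, 0) \<psi>\<^sub>0"
proof -
  have world: "(T i\<^sub>0, 0) \<in> Worlds"
    by (rule root_world) simp
  then show "(T i\<^sub>0, 0) \<in> worlds M"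
    by (simp add: M_def)
  have "\<psi>\<^sub>0 \<in> T i\<^sub>0"
    using root_in_fms[of r "\<sigma> 0"] by (auto simp: T_def Cl_def in_L_iff)
  with world show "sat M (T i\<^sub>0, 0) \<psi>\<^sub>0"
    by (rule sat_M)
qed

text \<open>Countability lets the model be copied into any infinite type of worlds, as validity is
  assumed only for models over the given type.\<close>

lemma countable_worlds: "countable (worlds M)"
proof -
  have "worlds M \<subseteq> T ` U \<times> UNIV"
    by (auto simp: M_def Worlds_def)
  then show ?thesis
    by (rule countable_subset) simp
qed

end


section \<open>Completeness\<close>

definition image_model :: "('a \<Rightarrow> 'b) \<Rightarrow> 'a model \<Rightarrow> 'b model" where
  "image_model f M = \<lparr>worlds = f ` worlds M, acc = map_prod f f ` acc M,
     val = (\<lambda>p. f ` val M p), den = (\<lambda>i. f (den M i))\<rparr>"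

text \<open>Edges join worlds only, and \<open>f\<close> is injective on worlds, so an edge leaving
  \<open>f w\<close> can come only from an edge leaving \<open>w\<close>.\<close>

lemma acc_image_model_iff:
  assumes "is_model M" "inj_on f (worlds M)" "w \<in> worlds M"
  shows "(f w, y) \<in> acc (image_model f M) \<longleftrightarrow> (\<exists>v. (w, v) \<in> acc M \<and> y = f v)"
proof -
  have "u = w" if "(u, v) \<in> acc M" "f u = f w" for u v
    using that assms by (auto simp: is_model_def inj_on_def)
  then show ?thesis
    by (fastforce simp: image_model_def)
qed

lemma sat_image_model:
  assumes "is_model M" "inj_on f (worlds M)" "w \<in> worlds M"
  shows "sat (image_model f M) (f w) \<phi> \<longleftrightarrow> sat M w \<phi>"
  using assms(3)
proof (induction \<phi> arbitrary: w)
  case (Pro p)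
  have "val M p \<subseteq> worlds M"
    using assms(1) by (simp add: is_model_def)
  then show ?case
    using Pro inj_on_image_mem_iff[OF assms(2)] by (simp add: image_model_def)
next
  case (Nom i)
  have "den M i \<in> worlds M"
    using assms(1) by (simp add: is_model_def)
  then show ?case
    using Nom inj_on_eq_iff[OF assms(2)] by (simp add: image_model_def)
next
  case (At i \<phi>)
  have "den M i \<in> worlds M"
    using assms(1) by (simp add: is_model_def)
  then show ?case
    using At.IH by (simp add: image_model_def)
next
  case (Dia \<phi>)
  have "v \<in> worlds M" if "(w, v) \<in> acc M" for v
    using that assms(1) by (auto simp: is_model_def)
  then show ?case
    using Dia acc_image_model_iff[OF assms(1,2)] by auto
next
  case (Box \<phi>)
  have "v \<in> worlds M" if "(w, v) \<in> acc M" for v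
    using that assms(1) by (auto simp: is_model_def)
  then show ?case
    using Box acc_image_model_iff[OF assms(1,2)] by auto
qed simp_all

lemma spo_model_image_model:
  assumes "spo_model M" "inj_on f (worlds M)"
  shows "spo_model (image_model f M)"
proof -
  let ?N = "image_model f M"
  have M: "is_model M" "irrefl (acc M)" "trans (acc M)"
    using assms(1) by (auto simp: spo_model_def)
  have sub: "acc M \<subseteq> worlds M \<times> worlds M"
    using M(1) by (simp add: is_model_def)
  have N: "is_model ?N"
    using M(1) unfolding is_model_def image_model_def by auto
  have acc: "(x, y) \<in> acc ?N \<longleftrightarrow> (\<exists>w v. (w, v) \<in> acc M \<and> x = f w \<and> y = f v)" for x y
    by (auto simp: image_model_def)
  have "(x, x) \<notin> acc ?N" for x
    using M(2) sub assms(2) unfolding acc irrefl_def inj_on_def by blast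
  moreover have "(x, z) \<in> acc ?N" if "(x, y) \<in> acc ?N" "(y, z) \<in> acc ?N" for x y z
  proof -
    from that obtain a b c d
      where "(a, b) \<in> acc M" "(c, d) \<in> acc M" "x = f a" "f b = f c" "z = f d"
      unfolding acc by metis
    moreover from this have "b = c"
      using sub assms(2) by (auto simp: inj_on_def)
    ultimately show ?thesis
      using M(3) unfolding acc trans_def by blast
  qed
  ultimately show ?thesis
    using N by (auto simp: spo_model_def irrefl_def intro: transI)
qed

theorem theorem3p26:
  fixes \<phi> :: fm
  assumes "infinite (UNIV :: 'w set)"
    and "\<And>(M :: 'w model) w. spo_model M \<Longrightarrow> w \<in> worlds M \<Longrightarrow> sat M w \<phi>"
  shows "provable \<phi>"
proof (rule ccontr)
  assume unprovable: "\<not> provable \<phi>"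
  obtain i where i: "i \<notin> noms \<phi>"
    using ex_new_if_finite[OF infinite_UNIV_nat finite_noms] by blast
  let ?r = "At i (neg \<phi>)"
  have "tableau i (neg \<phi>) (systematic ?r)"
    using i by (intro tableau_systematic) (simp add: noms_nnf)
  \<comment> \<open>The systematic tableau has an admissible root for a proof of
    \<open>\<phi>\<close>; as \<open>\<phi>\<close> is unprovable, it must have an open
    branch.\<close>
  then obtain B where B: "pred_on.maxchain (systematic ?r) strict_prefix B"
    "\<not> closed_fms (\<Union>\<Theta>\<in>B. fms ?r \<Theta>)"
    using unprovable i by (auto simp: provable_def closed_tableau_def branches_def)
  obtain \<sigma> where \<sigma>: "\<sigma> 0 = []" "\<And>n. \<sigma> n \<in> B"
    "\<And>n. (\<exists>s\<in>successors ?r (\<sigma> n). \<sigma> (Suc n) = \<sigma> n @ [s]) \<or>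
       successors ?r (\<sigma> n) = {} \<and> \<sigma> (Suc n) = \<sigma> n"
    using maxchain_sequence[OF B(1)] by blast
  interpret open_branch i "neg \<phi>" \<sigma>
  proof
    have "(\<Union>n. fms ?r (\<sigma> n)) \<subseteq> (\<Union>\<Theta>\<in>B. fms ?r \<Theta>)"
      using \<sigma>(2) by blast
    then show "\<not> closed_fms (\<Union>n. fms ?r (\<sigma> n))"
      using B(2) closed_fms_mono by metis
  qed (use \<sigma> Neg_in_subfms_nnf in blast)+
  obtain g :: "nat \<Rightarrow> 'w" where g: "inj g"
    using infinite_countable_subset[OF assms(1)] by blast
  \<comment> \<open>The worlds are numbered by naturals, which embed into the infinite type; the
    numbering is injective just on the worlds.\<close>
  let ?f = "g \<circ> to_nat_on (worlds M)"
  have f: "inj_on ?f (worlds M)"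
    using countable_worlds g by (intro comp_inj_on) (auto intro: inj_on_subset)
  \<comment> \<open>Validity is applied to the copy and pulled back to \<open>M\<close>, where the
    root world satisfies the negation of \<open>\<phi>\<close>.\<close>
  have "sat (image_model ?f M) (?f (T i, 0)) \<phi>"
    using spo_model_image_model[OF spo_model_M f] root_satisfied(1)
    by (intro assms(2)) (auto simp: image_model_def)
  moreover have "is_model M"
    using spo_model_M by (simp add: spo_model_def)
  ultimately have "sat M (T i, 0) \<phi>"
    using sat_image_model[OF _ f root_satisfied(1)] by blast
  then show False
    using root_satisfied(2) sat_nnf[of M "(T i, 0)" "Neg \<phi>"] by simp
qed

end
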